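(* Assume that the futures market quantities $q_k^F$, $k\in I\cup J$, have already been committed at the futures price $P^F$; that in the spot market all firms simultaneously maximize their profits; and that each generator $k$ has an estimation (conjecture) of the impact that its production, $q_{k\omega}^S$ and $q_k^F$, may have on the spot market price and on rival quantities. Then, given the futures market quantities $q_k^F$ for all $k$, at each scenario $\omega$ the equilibrium spot market price is expressed as $$P_{\omega}^S=\varphi_{\omega}\left[\hat{\gamma}_{\omega}^{S}+\beta_{\omega}^S\sum_{i\in I} \tau_{i\omega}\left(b_{i\omega}+c_{i\omega}q_{i}^F+\hat{\eta}_{i\omega}P_{\omega}^{S_{CO_2}}\right)-\beta_{\omega}^S\sum_{i\in I}q_i^F\right],$$ where $$\tau_{i\omega}=\frac{1}{\beta_{\omega}^S(1+\delta_i)+c_{i\omega}}\qquad\text{and}\qquad \varphi_{\omega}=\frac{1}{1+\beta_{\omega}^S\sum_{i\in I}\tau_{i\omega}}.$$ The parameter $\delta_i=\sum_{k\in I,\,k\neq i}\frac{\partial q_{k\omega}^S}{\partial q_{i\omega}^S}$ measures the level of competition of generator $i$ in the spot market: $\delta_i=-1$ represents perfect competition and $\delta_i=0$ characterizes Cournot competition.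
   Context: $I$ is the set of conventional generators, $J$ the set of renewable generators, and $\Omega$ the set of scenarios $\omega$. In a two-stage electricity market, generator $k\in I\cup J$ sells the quantity $q_k^F$ in the futures market (first stage) at the futures price $P^F$, and the quantity $q_{k\omega}^S$ in the spot market (second stage) at the spot price $P_\omega^S$ in scenario $\omega$. Conventional generator $i\in I$ also makes a futures commitment of emission allowances $\varepsilon_i^F$. The first-stage (futures) decisions are considered fixed in the spot market. The spot price of emission allowances $P_\omega^{S_{CO_2}}$ is exogenous, and $\hat\eta_{i\omega}$ is the emission intensity factor of conventional generator $i$ in scenario $\omega$. The production cost of conventional generator $i$ is $$C_{i\omega}(q_i^F,q_{i\omega}^S)=a_{i\omega}+b_{i\omega}(q_i^F+q_{i\omega}^S)+\tfrac12 c_{i\omega}(q_i^F+q_{i\omega}^S)^2,$$ with cost coefficients $a_{i\omega}\ge 0$, $b_{i\omega}\ge 0$, $c_{i\omega}\ge 0$. Its spot market profit in scenario $\omega$ is $$\Pi_{i\omega}^S=P^S_{\omega}q_{i\omega}^S-C_{i\omega}(q_i^F,q_{i\omega}^S)+P_{\omega}^{S_{CO_2}}\big(\varepsilon_{i}^F-\hat{\eta}_{i\omega}(q_i^F+q_{i\omega}^S)\big),$$ which generator $i$ maximizes over $q_{i\omega}^S$. Renewable generator $j\in J$ has total production $Q_{j\omega}=q_j^F+q_{j\omega}^S$, a stochastic parameter which is always fully dispatched at no cost and with no emissions, so that its spot quantity is $q_{j\omega}^S=Q_{j\omega}-q_j^F$; its profit is $(P^F-P_\omega^S)q_j^F+P_\omega^S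 Q_{j\omega}$. The spot inverse demand in scenario $\omega$ is $$P_{\omega}^S=\gamma_\omega^S-\beta_\omega^S\Big(\sum_{i\in I}(q_{i\omega}^S+q_i^F)+\sum_{j\in J}Q_{j\omega}\Big)=\hat{\gamma}_{\omega}^{S}-\beta_{\omega}^S\sum_{i\in I}(q_{i\omega}^S+q_i^F),$$ with $\gamma_\omega^S>0$, $\beta_\omega^S>0$ and $\hat{\gamma}_{\omega}^{S}=\gamma_{\omega}^{S}-\beta_{\omega}^S\sum_{j\in J}Q_{j\omega}$. In $\delta_i$, the derivatives $\frac{\partial q_{k\omega}^S}{\partial q_{i\omega}^S}$ are the responses of rivals' spot quantities conjectured by generator $i$, so that the conjectured effect of its spot quantity on the spot price is $\frac{\partial P_\omega^S}{\partial q_{i\omega}^S}=-\beta_\omega^S(1+\delta_i)$. *)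

theory Defs
  imports "HOL-Analysis.Derivative"
begin

text \<open>
  Data of the spot stage. Everything that is exogenous or already committed when the spot
  market clears is recorded here: generators of type \<open>'g\<close>, scenarios of type \<open>'s\<close>.
  Spot quantities are not part of the record; for a fixed scenario they form a profile
  of type \<open>'g \<Rightarrow> real\<close>, and negative values (buying back) are allowed.
\<close>

record ('g, 's) spot_market =
  conventional :: "'g set"
  renewable :: "'g set"
  scenarios :: "'s set"
  futures_price :: real
  futures_qty :: "'g \<Rightarrow> real"
  futures_allowances :: "'g \<Rightarrow> real"
  cost_a :: "'g \<Rightarrow> 's \<Rightarrow> real"
  cost_b :: "'g \<Rightarrow> 's \<Rightarrow> real"
  cost_c :: "'g \<Rightarrow> 's \<Rightarrow> real"
  emission :: "'g \<Rightarrow> 's \<Rightarrow> real"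
  allowance_price :: "'s \<Rightarrow> real"
  renewable_output :: "'g \<Rightarrow> 's \<Rightarrow> real"
  demand_intercept :: "'s \<Rightarrow> real"
  demand_slope :: "'s \<Rightarrow> real"

definition valid_market :: "('g, 's) spot_market \<Rightarrow> bool" where
  "valid_market M \<longleftrightarrow>
     finite (conventional M) \<and> finite (renewable M) \<and> conventional M \<inter> renewable M = {} \<and>
     (\<forall>i\<in>conventional M. \<forall>\<omega>\<in>scenarios M.
        cost_a M i \<omega> \<ge> 0 \<and> cost_b M i \<omega> \<ge> 0 \<and> cost_c M i \<omega> \<ge> 0) \<and>
     (\<forall>\<omega>\<in>scenarios M. demand_intercept M \<omega> > 0 \<and> demand_slope M \<omega> > 0)"

definition spot_price :: "('g, 's) spot_market \<Rightarrow> 's \<Rightarrow> ('g \<Rightarrow> real) \<Rightarrow> real" where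
  "spot_price M \<omega> s =
     demand_intercept M \<omega> -
     demand_slope M \<omega> * ((\<Sum>i\<in>conventional M. s i + futures_qty M i) +
                         (\<Sum>j\<in>renewable M. renewable_output M j \<omega>))"

definition net_intercept :: "('g, 's) spot_market \<Rightarrow> 's \<Rightarrow> real" where
  "net_intercept M \<omega> =
     demand_intercept M \<omega> - demand_slope M \<omega> * (\<Sum>j\<in>renewable M. renewable_output M j \<omega>)"

definition production_cost :: "('g, 's) spot_market \<Rightarrow> 's \<Rightarrow> 'g \<Rightarrow> real \<Rightarrow> real" where
  "production_cost M \<omega> i x =
     cost_a M i \<omega> + cost_b M i \<omega> * (futures_qty M i + x) +
     1/2 * cost_c M i \<omega> * (futures_qty M i + x)\<^sup>2"

definition conventional_profit ::
    "('g, 's) spot_market \<Rightarrow> 's \<Rightarrow> 'g \<Rightarrow> real \<Rightarrow> real \<Rightarrow> real" where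
  "conventional_profit M \<omega> i p x =
     p * x - production_cost M \<omega> i x +
     allowance_price M \<omega> * (futures_allowances M i - emission M i \<omega> * (futures_qty M i + x))"

definition renewable_profit ::
    "('g, 's) spot_market \<Rightarrow> 'g \<Rightarrow> real \<Rightarrow> real \<Rightarrow> real" where
  "renewable_profit M j p x =
     (futures_price M - p) * futures_qty M j + p * (futures_qty M j + x)"

text \<open>
  A system of conjectures \<open>R\<close> assigns to a scenario \<open>\<omega>\<close> and generators \<open>i\<close>, \<open>k\<close> the function
  \<open>R \<omega> i k\<close>: the spot quantity that \<open>i\<close> expects of its rival \<open>k\<close>, as a function of \<open>i\<close>'s own
  spot quantity. Only conventional rivals respond, because the total renewable output is fixed.
  Futures quantities are constants at this stage, so a dependence of the conjectures on them
  is absorbed in \<open>R\<close>.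
\<close>

type_synonym ('g, 's) conjectures = "'s \<Rightarrow> 'g \<Rightarrow> 'g \<Rightarrow> real \<Rightarrow> real"

definition conjectured_profile ::
    "('g, 's) conjectures \<Rightarrow> 's \<Rightarrow> 'g \<Rightarrow> real \<Rightarrow> 'g \<Rightarrow> real" where
  "conjectured_profile R \<omega> i x = (\<lambda>k. if k = i then x else R \<omega> i k x)"

definition conjectured_price ::
    "('g, 's) spot_market \<Rightarrow> ('g, 's) conjectures \<Rightarrow> 's \<Rightarrow> 'g \<Rightarrow> real \<Rightarrow> real" where
  "conjectured_price M R \<omega> i x = spot_price M \<omega> (conjectured_profile R \<omega> i x)"

definition competition_level ::
    "('g, 's) spot_market \<Rightarrow> ('g, 's) conjectures \<Rightarrow> 's \<Rightarrow> ('g \<Rightarrow> real) \<Rightarrow> 'g \<Rightarrow> real" where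
  "competition_level M R \<omega> s i = (\<Sum>k\<in>conventional M - {i}. deriv (R \<omega> i k) (s i))"

text \<open>
  Simultaneous profit maximization in scenario \<open>\<omega>\<close> at the profile \<open>s\<close>. Each conventional
  generator maximizes over all real spot quantities, anticipating the price according to its
  conjectures; these are differentiable at \<open>s\<close> and agree there with the quantities actually
  chosen by the rivals, so that all generators face the same equilibrium price. A renewable
  generator is always fully dispatched, so its feasible set is a single point.
\<close>

definition spot_equilibrium ::
    "('g, 's) spot_market \<Rightarrow> ('g, 's) conjectures \<Rightarrow> 's \<Rightarrow> ('g \<Rightarrow> real) \<Rightarrow> bool" where
  "spot_equilibrium M R \<omega> s \<longleftrightarrow>
     (\<forall>i\<in>conventional M.
        (\<forall>k\<in>conventional M - {i}.
           R \<omega> i k (s i) = s k \<and> R \<omega> i k field_differentiable (at (s i))) \<and>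
        is_arg_max (\<lambda>x. conventional_profit M \<omega> i (conjectured_price M R \<omega> i x) x)
          (\<lambda>x. True) (s i)) \<and>
     (\<forall>j\<in>renewable M.
        is_arg_max (\<lambda>x. renewable_profit M j (spot_price M \<omega> s) x)
          (\<lambda>x. futures_qty M j + x = renewable_output M j \<omega>) (s j))"

definition tau :: "('g, 's) spot_market \<Rightarrow> 's \<Rightarrow> ('g \<Rightarrow> real) \<Rightarrow> 'g \<Rightarrow> real" where
  "tau M \<omega> \<delta> i = 1 / (demand_slope M \<omega> * (1 + \<delta> i) + cost_c M i \<omega>)"

definition phi :: "('g, 's) spot_market \<Rightarrow> 's \<Rightarrow> ('g \<Rightarrow> real) \<Rightarrow> real" where
  "phi M \<omega> \<delta> = 1 / (1 + demand_slope M \<omega> * (\<Sum>i\<in>conventional M. tau M \<omega> \<delta> i))"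

text \<open>
  The two benchmark forms of competition, each in terms of the conjectured marginal effect of
  \<open>i\<close>'s quantity on the price and in terms of \<open>i\<close>'s decision problem: in perfect competition
  the generator regards the price as given, in Cournot competition it regards the
  quantities of its rivals as given.
\<close>

definition price_taking_conjecture ::
    "('g, 's) spot_market \<Rightarrow> ('g, 's) conjectures \<Rightarrow> 's \<Rightarrow> ('g \<Rightarrow> real) \<Rightarrow> 'g \<Rightarrow> bool" where
  "price_taking_conjecture M R \<omega> s i \<longleftrightarrow>
     (conjectured_price M R \<omega> i has_real_derivative 0) (at (s i))"

definition cournot_conjecture ::
    "('g, 's) spot_market \<Rightarrow> ('g, 's) conjectures \<Rightarrow> 's \<Rightarrow> ('g \<Rightarrow> real) \<Rightarrow> 'g \<Rightarrow> bool" where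
  "cournot_conjecture M R \<omega> s i \<longleftrightarrow>
     (conjectured_price M R \<omega> i has_real_derivative
        deriv (\<lambda>x. spot_price M \<omega> (s(i := x))) (s i)) (at (s i))"

definition price_taking_optimal ::
    "('g, 's) spot_market \<Rightarrow> 's \<Rightarrow> ('g \<Rightarrow> real) \<Rightarrow> 'g \<Rightarrow> bool" where
  "price_taking_optimal M \<omega> s i \<longleftrightarrow>
     is_arg_max (\<lambda>x. conventional_profit M \<omega> i (spot_price M \<omega> s) x) (\<lambda>x. True) (s i)"

definition cournot_optimal ::
    "('g, 's) spot_market \<Rightarrow> 's \<Rightarrow> ('g \<Rightarrow> real) \<Rightarrow> 'g \<Rightarrow> bool" where
  "cournot_optimal M \<omega> s i \<longleftrightarrow>
     is_arg_max (\<lambda>x. conventional_profit M \<omega> i (spot_price M \<omega> (s(i := x))) x)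
       (\<lambda>x. True) (s i)"

end

theory Submission
  imports Defs
begin

text \<open>
  At an interior maximum the conjectured marginal profit of each conventional generator vanishes.
  Since the conjectured price slope is \<open>- \<beta> (1 + \<delta>\<^sub>i)\<close>, this makes the spot quantity
  an affine function of the equilibrium price with slope \<open>\<tau>\<^sub>i\<close>; inserting these supply functions
  into the inverse demand and solving for the price gives the formula. For the benchmark cases,
  the profit against a linear residual demand is a concave quadratic, so the same first-order
  condition is also sufficient for optimality.
\<close>

text \<open>Marginal production cost plus the cost of the allowances that one more unit requires.
  The committed \<open>futures_allowances\<close> are constant in the spot quantity and leave no
  trace here.\<close>

definition marginal_cost :: "('g, 's) spot_market \<Rightarrow> 's \<Rightarrow> 'g \<Rightarrow> real \<Rightarrow> real" where
  "marginal_cost M \<omega> i x =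
     cost_b M i \<omega> + cost_c M i \<omega> * (futures_qty M i + x) + emission M i \<omega> * allowance_price M \<omega>"

lemma is_arg_max_UNIV_iff:
  fixes f :: "'a \<Rightarrow> 'b::linorder"
  shows "is_arg_max f (\<lambda>x. True) y \<longleftrightarrow> (\<forall>x. f x \<le> f y)"
  by (auto simp: is_arg_max_def not_less)

text \<open>The profit against a linear price is quadratic, so its Taylor expansion at
  \<open>y\<close> is exact: revenue contributes \<open>d\<close> to the second-order coefficient
  and the cost contributes \<open>- c / 2\<close>.\<close>

lemma conventional_profit_linear_price:
  "conventional_profit M \<omega> i (p + d * (x - y)) x =
     conventional_profit M \<omega> i p y + (p + d * y - marginal_cost M \<omega> i y) * (x - y)
       + (d - cost_c M i \<omega> / 2) * (x - y)\<^sup>2"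
  by (simp add: conventional_profit_def production_cost_def marginal_cost_def
      field_simps power2_eq_square)

text \<open>The first-order condition kills the linear term of the expansion, and the quadratic term
  is nonpositive. Price taking is the case \<open>d = 0\<close>, Cournot the case of
  \<open>d\<close> equal to minus the demand slope.\<close>

lemma conventional_profit_linear_price_optimal:
  assumes "p + d * y = marginal_cost M \<omega> i y" and "d \<le> 0" and "cost_c M i \<omega> \<ge> 0"
  shows "is_arg_max (\<lambda>x. conventional_profit M \<omega> i (p + d * (x - y)) x) (\<lambda>x. True) y"
proof -
  have "(d - cost_c M i \<omega> / 2) * (x - y)\<^sup>2 \<le> 0" for x
    using assms(2,3) by (intro mult_nonpos_nonneg) auto
  then show ?thesis
    unfolding is_arg_max_UNIV_iff conventional_profit_linear_price using assms(1) by simp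
qed

lemma DERIV_conventional_profit:
  assumes "(f has_real_derivative d) (at y)"
  shows "((\<lambda>x. conventional_profit M \<omega> i (f x) x) has_real_derivative
           f y + d * y - marginal_cost M \<omega> i y) (at y)"
  unfolding conventional_profit_def production_cost_def marginal_cost_def
  by (rule derivative_eq_intros assms refl | simp add: algebra_simps)+

lemma spot_price_cong:
  "(\<And>i. i \<in> conventional M \<Longrightarrow> s i = t i) \<Longrightarrow> spot_price M \<omega> s = spot_price M \<omega> t"
  unfolding spot_price_def by (simp cong: sum.cong)

lemma spot_price_eq_net_intercept:
  "spot_price M \<omega> s =
     net_intercept M \<omega> - demand_slope M \<omega> * (\<Sum>i\<in>conventional M. s i + futures_qty M i)"
  by (simp add: spot_price_def net_intercept_def algebra_simps)

text \<open>Puts the Cournot residual demand into the form \<open>p + d * (x - y)\<close> used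
  above.\<close>

lemma spot_price_update:
  assumes "finite (conventional M)" and "i \<in> conventional M"
  shows "spot_price M \<omega> (s(i := x)) = spot_price M \<omega> s + - demand_slope M \<omega> * (x - s i)"
proof -
  have "(\<Sum>k\<in>conventional M - {i}. (s(i := x)) k + futures_qty M k) =
      (\<Sum>k\<in>conventional M - {i}. s k + futures_qty M k)"
    by (intro sum.cong) auto
  then show ?thesis
    using assms by (simp add: spot_price_def sum.remove[of _ i] algebra_simps)
qed

text \<open>One extra unit of \<open>i\<close> adds itself and the conjectured responses of the
  rivals to total output; futures quantities and renewable output are constants.\<close>

lemma DERIV_conjectured_price:
  assumes "finite (conventional M)" and "i \<in> conventional M"
    and "\<And>k. k \<in> conventional M - {i} \<Longrightarrow> R \<omega> i k field_differentiable (at (s i))"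
  shows "(conjectured_price M R \<omega> i has_real_derivative
           - demand_slope M \<omega> * (1 + competition_level M R \<omega> s i)) (at (s i))"
proof -
  define S where "S = (\<lambda>x. \<Sum>k\<in>conventional M - {i}. R \<omega> i k x + futures_qty M k)"
  have eq: "conjectured_price M R \<omega> i =
      (\<lambda>x. net_intercept M \<omega> - demand_slope M \<omega> * (x + futures_qty M i + S x))"
  proof
    fix x
    have "(\<Sum>k\<in>conventional M - {i}. conjectured_profile R \<omega> i x k + futures_qty M k) = S x"
      unfolding S_def by (intro sum.cong) (auto simp: conjectured_profile_def)
    moreover have "conjectured_profile R \<omega> i x i = x"
      by (simp add: conjectured_profile_def)
    ultimately show "conjectured_price M R \<omega> i x =
        net_intercept M \<omega> - demand_slope M \<omega> * (x + futures_qty M i + S x)"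
      using assms(1,2)
      by (simp add: conjectured_price_def spot_price_eq_net_intercept sum.remove[of _ i])
  qed
  have "(S has_real_derivative competition_level M R \<omega> s i) (at (s i))"
    unfolding S_def competition_level_def
    \<comment> \<open>Differentiability is what makes each \<open>deriv\<close> in
      \<open>competition_level\<close> an actual derivative.\<close>
    by (intro DERIV_sum) (use assms(3) in
        \<open>auto intro!: derivative_eq_intros simp: DERIV_deriv_iff_field_differentiable\<close>)
  then show ?thesis
    unfolding eq by (auto intro!: derivative_eq_intros)
qed

text \<open>At equilibrium each conjecture returns the quantity that the rival really
  chooses.\<close>

lemma conjectured_price_at_equilibrium:
  assumes "spot_equilibrium M R \<omega> s" and "i \<in> conventional M"
  shows "conjectured_price M R \<omega> i (s i) = spot_price M \<omega> s"
  unfolding conjectured_price_def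
  using assms by (intro spot_price_cong) (auto simp: conjectured_profile_def spot_equilibrium_def)

text \<open>Spot quantities range over the whole real line, so every maximum is interior and the
  derivative of the conjectured profit vanishes there.\<close>

lemma spot_equilibrium_foc:
  assumes "finite (conventional M)" and "spot_equilibrium M R \<omega> s" and "i \<in> conventional M"
  shows "spot_price M \<omega> s - demand_slope M \<omega> * (1 + competition_level M R \<omega> s i) * s i =
           marginal_cost M \<omega> i (s i)"
proof -
  have "(conjectured_price M R \<omega> i has_real_derivative
      - demand_slope M \<omega> * (1 + competition_level M R \<omega> s i)) (at (s i))"
    using assms by (intro DERIV_conjectured_price) (auto simp: spot_equilibrium_def)
  note d = DERIV_conventional_profit[OF this, of M \<omega> i]
  have "\<forall>x. conventional_profit M \<omega> i (conjectured_price M R \<omega> i x) x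
      \<le> conventional_profit M \<omega> i (conjectured_price M R \<omega> i (s i)) (s i)"
    using assms(2,3) by (auto simp: spot_equilibrium_def is_arg_max_UNIV_iff)
  then have "conjectured_price M R \<omega> i (s i)
      + - demand_slope M \<omega> * (1 + competition_level M R \<omega> s i) * s i
      - marginal_cost M \<omega> i (s i) = 0"
    \<comment> \<open>The maximum is global, so the radius 1 of the neighbourhood is
      arbitrary.\<close>
    by (intro DERIV_local_max[OF d zero_less_one]) auto
  then show ?thesis
    using conjectured_price_at_equilibrium[OF assms(2,3)] by simp
qed

text \<open>Summing the affine supplies and inserting them into inverse demand leaves one linear
  equation in the price; \<open>phi\<close> is the reciprocal of the coefficient of the
  price.\<close>

lemma spot_price_affine_supply:
  assumes quantity: "\<And>i. i \<in> conventional M \<Longrightarrow> s i = tau M \<omega> \<delta> i * (spot_price M \<omega> s - m i)"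
    and nz: "1 + demand_slope M \<omega> * (\<Sum>i\<in>conventional M. tau M \<omega> \<delta> i) \<noteq> 0"
  shows "spot_price M \<omega> s = phi M \<omega> \<delta> *
           (net_intercept M \<omega> + demand_slope M \<omega> * (\<Sum>i\<in>conventional M. tau M \<omega> \<delta> i * m i)
            - demand_slope M \<omega> * (\<Sum>i\<in>conventional M. futures_qty M i))"
proof -
  have "(\<Sum>i\<in>conventional M. s i) =
      (\<Sum>i\<in>conventional M. tau M \<omega> \<delta> i * (spot_price M \<omega> s - m i))"
    using quantity by (intro sum.cong) auto
  also have "\<dots> = (\<Sum>i\<in>conventional M. tau M \<omega> \<delta> i) * spot_price M \<omega> s
      - (\<Sum>i\<in>conventional M. tau M \<omega> \<delta> i * m i)"
    by (simp add: right_diff_distrib sum_subtractf sum_distrib_right)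
  finally have "spot_price M \<omega> s = net_intercept M \<omega> - demand_slope M \<omega> *
      ((\<Sum>i\<in>conventional M. tau M \<omega> \<delta> i) * spot_price M \<omega> s
       - (\<Sum>i\<in>conventional M. tau M \<omega> \<delta> i * m i) + (\<Sum>i\<in>conventional M. futures_qty M i))"
    using spot_price_eq_net_intercept[of M \<omega> s] by (simp add: sum.distrib)
  then have "spot_price M \<omega> s * (1 + demand_slope M \<omega> * (\<Sum>i\<in>conventional M. tau M \<omega> \<delta> i)) =
      net_intercept M \<omega> + demand_slope M \<omega> * (\<Sum>i\<in>conventional M. tau M \<omega> \<delta> i * m i)
      - demand_slope M \<omega> * (\<Sum>i\<in>conventional M. futures_qty M i)"
    by (simp add: algebra_simps)
  then show ?thesis
    using nz by (simp add: phi_def nonzero_eq_divide_eq)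
qed

theorem proposition1:
  fixes M :: "('g, 's) spot_market"
    and R :: "('g, 's) conjectures"
    and q :: "'s \<Rightarrow> 'g \<Rightarrow> real"
    and \<delta> :: "'g \<Rightarrow> real"
    and \<omega> :: 's
  assumes "valid_market M"
    and "\<omega> \<in> scenarios M"
    and "spot_equilibrium M R \<omega> (q \<omega>)"
    and "\<forall>i\<in>conventional M. \<delta> i = competition_level M R \<omega> (q \<omega>) i"
    and "\<forall>i\<in>conventional M. demand_slope M \<omega> * (1 + \<delta> i) + cost_c M i \<omega> \<noteq> 0"
    and "1 + demand_slope M \<omega> * (\<Sum>i\<in>conventional M. tau M \<omega> \<delta> i) \<noteq> 0"
  shows "spot_price M \<omega> (q \<omega>) =
           phi M \<omega> \<delta> *
             (net_intercept M \<omega>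
              + demand_slope M \<omega> *
                  (\<Sum>i\<in>conventional M. tau M \<omega> \<delta> i *
                     (cost_b M i \<omega> + cost_c M i \<omega> * futures_qty M i
                      + emission M i \<omega> * allowance_price M \<omega>))
              - demand_slope M \<omega> * (\<Sum>i\<in>conventional M. futures_qty M i))
         \<and> (\<forall>i\<in>conventional M.
              (\<delta> i = -1 \<longleftrightarrow> price_taking_conjecture M R \<omega> (q \<omega>) i) \<and>
              (\<delta> i = -1 \<longrightarrow> price_taking_optimal M \<omega> (q \<omega>) i) \<and>
              (\<delta> i = 0 \<longleftrightarrow> cournot_conjecture M R \<omega> (q \<omega>) i) \<and>
              (\<delta> i = 0 \<longrightarrow> cournot_optimal M \<omega> (q \<omega>) i))"
proof (intro conjI ballI)
  define \<beta> where "\<beta> = demand_slope M \<omega>"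
  have fin: "finite (conventional M)" and \<beta>: "\<beta> > 0"
    using assms(1,2) by (auto simp: valid_market_def \<beta>_def)
  have foc: "spot_price M \<omega> (q \<omega>) - \<beta> * (1 + \<delta> i) * q \<omega> i = marginal_cost M \<omega> i (q \<omega> i)"
    if "i \<in> conventional M" for i
    using spot_equilibrium_foc[OF fin assms(3) that] assms(4) that by (simp add: \<beta>_def)
  \<comment> \<open>\<open>?m i\<close> is the marginal cost at spot quantity zero, the price at
    which the supply of \<open>i\<close> vanishes.\<close>
  let ?m = "\<lambda>i. cost_b M i \<omega> + cost_c M i \<omega> * futures_qty M i
    + emission M i \<omega> * allowance_price M \<omega>"
  have "q \<omega> i = tau M \<omega> \<delta> i * (spot_price M \<omega> (q \<omega>) - ?m i)" if "i \<in> conventional M" for i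
  proof -
    \<comment> \<open>The part of marginal cost linear in the spot quantity moves to the left, where
      it completes the denominator of \<open>tau\<close>.\<close>
    have "(\<beta> * (1 + \<delta> i) + cost_c M i \<omega>) * q \<omega> i = spot_price M \<omega> (q \<omega>) - ?m i"
      using foc[OF that] by (simp add: marginal_cost_def algebra_simps)
    then show ?thesis
      using assms(5) that by (simp add: tau_def nonzero_eq_divide_eq \<beta>_def mult.commute)
  qed
  then show "spot_price M \<omega> (q \<omega>) = phi M \<omega> \<delta> * (net_intercept M \<omega>
      + demand_slope M \<omega> * (\<Sum>i\<in>conventional M. tau M \<omega> \<delta> i * ?m i)
      - demand_slope M \<omega> * (\<Sum>i\<in>conventional M. futures_qty M i))"
    using assms(6) by (rule spot_price_affine_supply)

  fix i
  assume i: "i \<in> conventional M"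
  have c: "cost_c M i \<omega> \<ge> 0"
    using assms(1,2) i by (auto simp: valid_market_def)
  note update = spot_price_update[OF fin i, of \<omega> "q \<omega>"]
  have "(conjectured_price M R \<omega> i has_real_derivative - \<beta> * (1 + \<delta> i)) (at (q \<omega> i))"
    using DERIV_conjectured_price[OF fin i, of R \<omega> "q \<omega>"] assms(3,4) i
    by (auto simp: spot_equilibrium_def \<beta>_def)
  \<comment> \<open>As derivatives are unique, each conjecture notion becomes an equation for
    \<delta>, solvable because \<beta> is positive.\<close>
  then have slope: "(conjectured_price M R \<omega> i has_real_derivative d) (at (q \<omega> i))
      \<longleftrightarrow> d = - \<beta> * (1 + \<delta> i)" for d
    using DERIV_unique by blast
  show "\<delta> i = -1 \<longleftrightarrow> price_taking_conjecture M R \<omega> (q \<omega>) i"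
    unfolding price_taking_conjecture_def slope using \<beta> by auto
  have "((\<lambda>x. spot_price M \<omega> ((q \<omega>)(i := x))) has_real_derivative - \<beta>) (at (q \<omega> i))"
    unfolding update \<beta>_def by (auto intro!: derivative_eq_intros)
  then have "deriv (\<lambda>x. spot_price M \<omega> ((q \<omega>)(i := x))) (q \<omega> i) = - \<beta>"
    by (rule DERIV_imp_deriv)
  then show "\<delta> i = 0 \<longleftrightarrow> cournot_conjecture M R \<omega> (q \<omega>) i"
    unfolding cournot_conjecture_def slope using \<beta> by auto
  show "\<delta> i = -1 \<longrightarrow> price_taking_optimal M \<omega> (q \<omega>) i"
    \<comment> \<open>With \<open>\<delta> i = -1\<close> the first-order condition says that price
      equals marginal cost.\<close>
    using conventional_profit_linear_price_optimal
        [of "spot_price M \<omega> (q \<omega>)" 0 "q \<omega> i" M \<omega> i] foc[OF i] c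
    by (auto simp: price_taking_optimal_def)
  show "\<delta> i = 0 \<longrightarrow> cournot_optimal M \<omega> (q \<omega>) i"
    \<comment> \<open>With \<open>\<delta> i = 0\<close> the conjectured slope in \<open>foc\<close>
      is the true slope of residual demand.\<close>
    using conventional_profit_linear_price_optimal
        [of "spot_price M \<omega> (q \<omega>)" "- \<beta>" "q \<omega> i" M \<omega> i] foc[OF i] c \<beta>
    unfolding cournot_optimal_def update by (auto simp: \<beta>_def)
qed

end
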